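(* Let $S\subset[0,1]^2$ be the standard Sierpiński carpet and let $\mathcal V$ be the set of all vertices of peripheral squares of its construction. The set $\mathcal V$ is dense in $S$. Moreover, for every $x\in\mathcal V$, \[ \dim_{\mathrm{Pbox}}\{x\}_S=\frac{\log 8}{\log 3}, \] whereas \[ \dim_{\times}\{x\}_S=2. \] In particular, on the dense subset $\mathcal V\subset S$, $\dim_{\mathrm{Pbox}}\{x\}_S<\dim_{\times}\{x\}_S$.
   Context: $S$ is the unique nonempty compact set with $S=\bigcup_{0\le i,j\le2,\,(i,j)\ne(1,1)}\frac{S+(i,j)}{3}$; equivalently it is obtained from $[0,1]^2$ by repeatedly subdividing each surviving square into nine equal subsquares and removing the open middle one. $\mathcal V$ consists of the four vertices of the initial unit square together with the four vertices of every middle square removed at any stage. Tangent cone: for $A\subset\mathbb{R}^n$, $\mathrm{Tan}_x(A)$ is the set of $v\in\mathbb{R}^n$ for which there exist $x_k\in A$, $x_k\to x$, and positive reals $\lambda_k\downarrow0$ with $(x_k-x)/\lambda_k\to v$. Effective directions: $\mathrm{Eff}_x(A):=\mathrm{Tan}_x(A)\cap S^{n-1}$ (with $S^{n-1}$ the unit sphere) if $x\in\overline A$ (and $\varnothing$ otherwise). For $v\ne0$ let $[v]=\mathbb{R}v\in\mathbb{P}^{n-1}$; $\mathrm{Eff}_x^{\mathbb P}(A):=\{[v]:v\in\mathrm{Eff}_x(A)\}$. Admissible probes: for $x\in\overline A$, $v\in S^{n-1}$, $\mathcal G_x^A(v)$ is the family of all injective Lipschitz maps $\gamma:[0,\delta]\to\mathbb{R}^n$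 (some $\delta>0$) with $\gamma(0)=x$, $\lim_{t\to0^+}\frac{\gamma(t)-x}{\|\gamma(t)-x\|}=v$, and $A\cap\gamma((0,\eta])\ne\varnothing$ for every $\eta\in(0,\delta]$; $\Gamma_\gamma:=\gamma([0,\delta])$. Point-extended box dimension: for bounded $E$, $N_\varepsilon(E)$ is the minimal number of sets of diameter at most $\varepsilon$ covering $E$ and $\overline{\dim}_B(E):=\limsup_{\varepsilon\to0}\frac{\ln N_\varepsilon(E)}{\ln(1/\varepsilon)}$. For $x\in\overline E$, $\dim_{\mathrm{Pbox}}\{x\}_E:=\inf_{r>0}\overline{\dim}_B(E\cap B(x,r))$; it is $0$ if $x\notin\overline E$. Directional contribution: for $v\in\mathrm{Eff}_x(A)$, $\theta_x^A(v):=\sup_{\gamma\in\mathcal G_x^A(v)}\dim_{\mathrm{Pbox}}\{x\}_{A\cap\Gamma_\gamma}$; for $\xi\in\mathrm{Eff}_x^{\mathbb P}(A)$, $\theta_x^A(\xi):=\sup\{\theta_x^A(w):w\in\mathrm{Eff}_x(A),[w]=\xi\}$. Point-Cross dimension at $x\in\overline A$: $\dim_\times\{x\}_A:=\sup\sum_{i=1}^m\theta_x^A(\xi_i)$ over all $m\in\{0,\dots,n\}$ and all $\xi_1,\dots,\xi_m\in\mathrm{Eff}_x^{\mathbb P}(A)$ that are projectively (linearly) independent, i.e. nonzero representatives are linearly independent (empty family allowed, with sum $0$). *)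

theory Defs
  imports "HOL-Analysis.Analysis"
begin

section \<open>Tangent cones and effective directions\<close>

definition tangent_cone :: "'a::euclidean_space set \<Rightarrow> 'a \<Rightarrow> 'a set" where
  "tangent_cone A x = {v. \<exists>(X :: nat \<Rightarrow> 'a) (l :: nat \<Rightarrow> real).
      (\<forall>k. X k \<in> A) \<and> X \<longlonglongrightarrow> x \<and>
      (\<forall>k. 0 < l k) \<and> decseq l \<and> l \<longlonglongrightarrow> 0 \<and>
      (\<lambda>k. (X k - x) /\<^sub>R l k) \<longlonglongrightarrow> v}"

definition eff_dirs :: "'a::euclidean_space set \<Rightarrow> 'a \<Rightarrow> 'a set" where
  "eff_dirs A x = (if x \<in> closure A then tangent_cone A x \<inter> sphere 0 1 else {})"

text \<open>A point of the projective space is represented by the line \<open>span {v}\<close>, \<open>v \<noteq> 0\<close>.\<close>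

definition proj_eff_dirs :: "'a::euclidean_space set \<Rightarrow> 'a \<Rightarrow> 'a set set" where
  "proj_eff_dirs A x = (\<lambda>v. span {v}) ` eff_dirs A x"


section \<open>Admissible probes\<close>

text \<open>A map on \<open>[0, \<delta>]\<close> is a total function \<open>g\<close> together with \<open>\<delta>\<close>; only its values on
  \<open>{0..\<delta>}\<close> are ever used.\<close>

definition probes :: "'a::euclidean_space set \<Rightarrow> 'a \<Rightarrow> 'a \<Rightarrow> (real \<times> (real \<Rightarrow> 'a)) set" where
  "probes A x v = {(\<delta>, g). 0 < \<delta> \<and> inj_on g {0..\<delta>} \<and> (\<exists>L. L-lipschitz_on {0..\<delta>} g) \<and>
      g 0 = x \<and>
      ((\<lambda>t. (g t - x) /\<^sub>R norm (g t - x)) \<longlongrightarrow> v) (at_right 0) \<and>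
      (\<forall>\<eta>. 0 < \<eta> \<and> \<eta> \<le> \<delta> \<longrightarrow> A \<inter> g ` {0<..\<eta>} \<noteq> {})}"


section \<open>Point-extended box dimension\<close>

text \<open>The library's \<open>diameter\<close> is meaningful for bounded sets only, hence the explicit
  boundedness of the covering sets.\<close>

definition covering_number :: "real \<Rightarrow> 'a::euclidean_space set \<Rightarrow> nat" where
  "covering_number \<epsilon> E = (LEAST n. \<exists>F. finite F \<and> card F = n \<and> E \<subseteq> \<Union>F \<and>
      (\<forall>U\<in>F. bounded U \<and> diameter U \<le> \<epsilon>))"

definition upper_box_dim :: "'a::euclidean_space set \<Rightarrow> ereal" where
  "upper_box_dim E =
     Limsup (at_right 0) (\<lambda>\<epsilon>. ereal (ln (real (covering_number \<epsilon> E)) / ln (1 / \<epsilon>)))"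

definition pbox_dim :: "'a::euclidean_space set \<Rightarrow> 'a \<Rightarrow> ereal" where
  "pbox_dim E x = (if x \<in> closure E then INF r\<in>{0<..}. upper_box_dim (E \<inter> ball x r) else 0)"


section \<open>Point-Cross dimension\<close>

text \<open>For \<open>v \<in> eff_dirs A x\<close> there is always a probe (a polygonal path through suitable points of
  \<open>A\<close>), so the value of an empty supremum in \<^typ>\<open>ereal\<close> plays no role.\<close>

definition dir_contrib :: "'a::euclidean_space set \<Rightarrow> 'a \<Rightarrow> 'a \<Rightarrow> ereal" where
  "dir_contrib A x v = (SUP (\<delta>, g)\<in>probes A x v. pbox_dim (A \<inter> g ` {0..\<delta>}) x)"

definition proj_contrib :: "'a::euclidean_space set \<Rightarrow> 'a \<Rightarrow> 'a set \<Rightarrow> ereal" where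
  "proj_contrib A x \<xi> = (SUP w\<in>{w \<in> eff_dirs A x. span {w} = \<xi>}. dir_contrib A x w)"

text \<open>Independence of a family \<open>\<xi> 0, \<dots>, \<xi> (m - 1)\<close>. Whether a choice of nonzero representatives is
  linearly independent does not depend on the choice. Injectivity is needed because
  \<open>independent\<close> speaks about a set of vectors, not about a family.\<close>

definition proj_independent :: "nat \<Rightarrow> (nat \<Rightarrow> 'a::euclidean_space set) \<Rightarrow> bool" where
  "proj_independent m \<xi> \<longleftrightarrow> (\<exists>w. (\<forall>i<m. w i \<noteq> 0 \<and> span {w i} = \<xi> i) \<and>
      inj_on w {..<m} \<and> independent (w ` {..<m}))"

definition cross_dim :: "'a::euclidean_space set \<Rightarrow> 'a \<Rightarrow> ereal" where
  "cross_dim A x =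
     (SUP (m, \<xi>)\<in>{(m, \<xi>). m \<le> DIM('a) \<and> (\<forall>i<m. \<xi> i \<in> proj_eff_dirs A x) \<and> proj_independent m \<xi>}.
        \<Sum>i<m. proj_contrib A x (\<xi> i))"


section \<open>The Sierpinski carpet\<close>

definition carpet_digits :: "(nat \<times> nat) set" where
  "carpet_digits = {0..2} \<times> {0..2} - {(1, 1)}"

definition pt :: "real \<Rightarrow> real \<Rightarrow> real ^ 2" where
  "pt a b = vector [a, b]"

definition carpet_step :: "(real ^ 2) set \<Rightarrow> (real ^ 2) set" where
  "carpet_step S = (\<Union>(i, j)\<in>carpet_digits. (\<lambda>p. (p + pt (real i) (real j)) /\<^sub>R 3) ` S)"

definition carpet :: "(real ^ 2) set" where
  "carpet = (THE S. S \<noteq> {} \<and> compact S \<and> S = carpet_step S)"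

text \<open>Lower left corners of the squares of side \<open>1 / 3 ^ k\<close> that survive at stage \<open>k\<close>.\<close>

fun carpet_cells :: "nat \<Rightarrow> (real ^ 2) set" where
  "carpet_cells 0 = {0}"
| "carpet_cells (Suc k) =
     {a + pt (real i) (real j) /\<^sub>R 3 ^ Suc k | a i j. a \<in> carpet_cells k \<and> (i, j) \<in> carpet_digits}"

definition square_vertices :: "real ^ 2 \<Rightarrow> real \<Rightarrow> (real ^ 2) set" where
  "square_vertices a s = {a, a + pt s 0, a + pt 0 s, a + pt s s}"

definition carpet_vertices :: "(real ^ 2) set" where
  "carpet_vertices = square_vertices 0 1 \<union>
     (\<Union>k. \<Union>a\<in>carpet_cells k. square_vertices (a + pt 1 1 /\<^sub>R 3 ^ Suc k) (1 / 3 ^ Suc k))"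


subsection \<open>The definition of the carpet is meaningful\<close>

lemma compact_carpet_step: "compact S \<Longrightarrow> compact (carpet_step S)"
  unfolding carpet_step_def
  by (intro compact_UN) (auto simp: carpet_digits_def intro!: compact_continuous_image continuous_intros)

lemma carpet_step_mono: "S \<subseteq> T \<Longrightarrow> carpet_step S \<subseteq> carpet_step T"
  unfolding carpet_step_def by blast

lemma pt_nth [simp]: "pt a b $ 1 = a" "pt a b $ 2 = b"
  by (simp_all add: pt_def)

lemma carpet_step_unit_square: "carpet_step (cbox 0 (pt 1 1)) \<subseteq> cbox 0 (pt 1 1)"
  unfolding carpet_step_def carpet_digits_def
  by (auto simp: mem_box_cart forall_2)

lemma carpet_unique_aux:
  assumes "S \<noteq> {}" "compact S" "S = carpet_step S" "T \<noteq> {}" "compact T" "T = carpet_step T"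
  shows "S \<subseteq> T"
proof
  fix x assume x: "x \<in> S"
  have "bounded (S \<union> T)"
    using assms compact_imp_bounded by auto
  then obtain D where D: "\<And>y z. y \<in> S \<union> T \<Longrightarrow> z \<in> S \<union> T \<Longrightarrow> dist y z \<le> D"
    using bounded_two_points by metis
  have *: "\<forall>y\<in>S. \<exists>z\<in>T. dist y z \<le> D / 3 ^ n" for n
  proof (induction n)
    case 0
    then show ?case using D assms(4) by fastforce
  next
    case (Suc n)
    show ?case
    proof
      fix y assume "y \<in> S"
      then have "y \<in> carpet_step S" using equalityD1[OF assms(3)] by (rule rev_subsetD)
      then obtain i j y' where ij: "(i, j) \<in> carpet_digits" "y' \<in> S"
        and y: "y = (y' + pt (real i) (real j)) /\<^sub>R 3"
        unfolding carpet_step_def by auto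
      obtain z' where z': "z' \<in> T" "dist y' z' \<le> D / 3 ^ n" using Suc ij by blast
      define z where "z = (z' + pt (real i) (real j)) /\<^sub>R 3"
      have "z \<in> carpet_step T"
        unfolding carpet_step_def z_def using ij z' by force
      then have "z \<in> T" using equalityD2[OF assms(6)] by (rule rev_subsetD)
      moreover have "dist y z = dist y' z' / 3"
      proof -
        have "y - z = (y' - z') /\<^sub>R 3"
          unfolding y z_def scaleR_diff_right[symmetric] by (simp only: add_diff_cancel_right)
        then show ?thesis by (simp add: dist_norm)
      qed
      ultimately show "\<exists>z\<in>T. dist y z \<le> D / 3 ^ Suc n"
        using divide_right_mono[OF z'(2), of 3] by (intro bexI[of _ z]) (simp_all add: mult.commute)
    qed
  qed
  have "x \<in> closure T"
    unfolding closure_approachable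
  proof (intro allI impI)
    fix e :: real assume "e > 0"
    obtain n where "D / e < 3 ^ n"
      using real_arch_pow[of 3 "D / e"] by auto
    with \<open>e > 0\<close> have "D / 3 ^ n < e"
      by (simp add: pos_divide_less_eq mult.commute)
    moreover obtain z where "z \<in> T" "dist x z \<le> D / 3 ^ n" using * x by blast
    ultimately show "\<exists>y\<in>T. dist y x < e" by (metis dist_commute le_less_trans)
  qed
  then show "x \<in> T" using assms(5) by (simp add: compact_imp_closed)
qed

lemma carpet_ex1: "\<exists>!S. S \<noteq> {} \<and> compact S \<and> S = carpet_step S"
proof (rule ex_ex1I)
  define K where "K n = (carpet_step ^^ n) (cbox 0 (pt 1 1))" for n
  have K_Suc: "K (Suc n) = carpet_step (K n)" for n by (simp add: K_def)
  have dec: "K (Suc n) \<subseteq> K n" for n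
  proof (induction n)
    case 0
    show ?case using carpet_step_unit_square by (simp add: K_def)
  next
    case (Suc n)
    then show ?case using carpet_step_mono by (metis K_Suc)
  qed
  have anti: "m \<le> n \<Longrightarrow> K n \<subseteq> K m" for m n
    using lift_Suc_antimono_le[of K] dec by blast
  have compact_K: "compact (K n)" for n
  proof (induction n)
    case 0
    show ?case by (simp add: K_def compact_cbox)
  next
    case (Suc n)
    then show ?case by (simp add: K_Suc compact_carpet_step)
  qed
  have pt0: "pt 0 0 = 0" by (simp add: vec_eq_iff forall_2)
  have zero: "0 \<in> K n" for n
  proof (induction n)
    case 0
    show ?case by (auto simp: K_def mem_box_cart forall_2)
  next
    case (Suc n)
    have "0 = (0 + pt (real 0) (real 0)) /\<^sub>R 3" "(0, 0) \<in> carpet_digits"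
      by (simp_all add: pt0 carpet_digits_def)
    then show ?case unfolding K_Suc carpet_step_def using Suc by blast
  qed
  define S where "S = (\<Inter>n. K n)"
  have "compact S" unfolding S_def using compact_K by (intro compact_Inter) auto
  moreover have "S \<noteq> {}" using zero by (auto simp: S_def)
  moreover have "carpet_step S \<subseteq> S"
  proof
    fix x assume x: "x \<in> carpet_step S"
    have "x \<in> K n" for n
    proof -
      have "S \<subseteq> K n" by (auto simp: S_def)
      then show ?thesis using x carpet_step_mono dec K_Suc by blast
    qed
    then show "x \<in> S" by (simp add: S_def)
  qed
  moreover have "S \<subseteq> carpet_step S"
  proof
    fix x assume x: "x \<in> S"
    have "\<exists>d\<in>carpet_digits. x \<in> (\<lambda>p. (p + pt (real (fst d)) (real (snd d))) /\<^sub>R 3) ` K n" for n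
    proof -
      have "x \<in> carpet_step (K n)" using x K_Suc by (auto simp: S_def)
      then show ?thesis by (force simp: carpet_step_def)
    qed
    then obtain d where d: "\<And>n. d n \<in> carpet_digits"
      "\<And>n. x \<in> (\<lambda>p. (p + pt (real (fst (d n))) (real (snd (d n)))) /\<^sub>R 3) ` K n"
      by metis
    have "finite carpet_digits" by (simp add: carpet_digits_def)
    then have "finite (range d)"
      by (rule finite_subset[rotated]) (use d(1) in blast)
    then obtain m where m: "infinite {n. d n = d m}"
      using pigeonhole_infinite[of UNIV d] by auto
    define q where "q = 3 *\<^sub>R x - pt (real (fst (d m))) (real (snd (d m)))"
    have "q \<in> K n" for n
    proof -
      obtain n' where n': "n' \<ge> n" "d n' = d m"
        using m unfolding infinite_nat_iff_unbounded_le by blast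
      then obtain p where "p \<in> K n'" "x = (p + pt (real (fst (d m))) (real (snd (d m)))) /\<^sub>R 3"
        using d(2)[of n'] by auto
      then have "q \<in> K n'" by (simp add: q_def)
      then show ?thesis using anti n' by blast
    qed
    then have "q \<in> S" by (simp add: S_def)
    moreover have "x = (q + pt (real (fst (d m))) (real (snd (d m)))) /\<^sub>R 3"
      by (simp add: q_def)
    moreover have "(fst (d m), snd (d m)) \<in> carpet_digits" using d(1)[of m] by simp
    ultimately show "x \<in> carpet_step S"
      unfolding carpet_step_def by blast
  qed
  ultimately have "S \<noteq> {} \<and> compact S \<and> S = carpet_step S"
    by (intro conjI subset_antisym)
  then show "\<exists>S. S \<noteq> {} \<and> compact S \<and> S = carpet_step S" by (rule exI)
next
  fix S T :: "(real ^ 2) set"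
  assume S: "S \<noteq> {} \<and> compact S \<and> S = carpet_step S"
    and T: "T \<noteq> {} \<and> compact T \<and> T = carpet_step T"
  note S' = S[THEN conjunct1] S[THEN conjunct2, THEN conjunct1] S[THEN conjunct2, THEN conjunct2]
  note T' = T[THEN conjunct1] T[THEN conjunct2, THEN conjunct1] T[THEN conjunct2, THEN conjunct2]
  show "S = T"
    by (rule subset_antisym[OF carpet_unique_aux[OF S' T'] carpet_unique_aux[OF T' S']])
qed

lemma carpet_props: "carpet \<noteq> {} \<and> compact carpet \<and> carpet = carpet_step carpet"
  unfolding carpet_def by (rule theI'[OF carpet_ex1])

end

theory Submission
  imports Defs
begin

text \<open>At a vertex of a peripheral square two perpendicular sides of the square start. Both lie in
  the carpet, so both directions are effective and contribute \<open>1\<close>; they contribute no more, because a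
  Lipschitz curve has upper box dimension at most \<open>1\<close>. The box dimension at any point of the carpet
  is computed from the \<open>8 ^ k\<close> cells of side \<open>3 ^ -k\<close>: they cover the carpet, and their
  lower left corners lie in the carpet at mutual distances at least \<open>3 ^ -k\<close>, while every
  neighbourhood of a point contains a whole cell, which is a scaled copy of the carpet.\<close>

section \<open>Covering numbers and box dimension\<close>

lemma covering_number_le:
  assumes "finite F" "E \<subseteq> \<Union>F" "\<And>U. U \<in> F \<Longrightarrow> bounded U \<and> diameter U \<le> \<epsilon>"
  shows "covering_number \<epsilon> E \<le> card F"
  unfolding covering_number_def by (rule Least_le) (use assms in blast)

text \<open>Points more than \<epsilon> apart lie in different members of any cover by sets of
  diameter at most \<epsilon>, so choosing a member for each point of \<open>P\<close> is
  injective.\<close>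

lemma card_le_covering_number:
  assumes E: "bounded E" and \<epsilon>: "0 < \<epsilon>"
    and P: "P \<subseteq> E" "\<And>p q. p \<in> P \<Longrightarrow> q \<in> P \<Longrightarrow> p \<noteq> q \<Longrightarrow> \<epsilon> < dist p q"
  shows "card P \<le> covering_number \<epsilon> E"
proof -
  let ?C = "\<lambda>F. finite F \<and> E \<subseteq> \<Union>F \<and> (\<forall>U\<in>F. bounded U \<and> diameter U \<le> \<epsilon>)"
  \<comment> \<open>Total boundedness yields one finite admissible cover, so the
    \<open>LEAST\<close> in \<open>covering_number\<close> is attained by an actual cover.\<close>
  have "compact (closure E)" using E by simp
  then obtain K where K: "finite K" "closure E \<subseteq> (\<Union>x\<in>K. ball x (\<epsilon>/2))"
    unfolding compact_eq_totally_bounded using \<epsilon> half_gt_zero by metis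
  have "?C ((\<lambda>x. ball x (\<epsilon>/2)) ` K)"
    using K closure_subset[of E] \<epsilon> by (auto simp: diameter_ball)
  then have "\<exists>n F. finite F \<and> card F = n \<and> E \<subseteq> \<Union>F \<and> (\<forall>U\<in>F. bounded U \<and> diameter U \<le> \<epsilon>)"
    by (metis (no_types, lifting))
  from LeastI_ex[OF this] obtain F where F: "?C F" "card F = covering_number \<epsilon> E"
    unfolding covering_number_def by (elim exE conjE) simp
  have "\<exists>f. \<forall>p\<in>P. f p \<in> F \<and> p \<in> f p"
    using F P(1) by (intro bchoice) blast
  then obtain f where f: "\<And>p. p \<in> P \<Longrightarrow> f p \<in> F \<and> p \<in> f p" by blast
  have "inj_on f P"
  proof (rule inj_onI, rule ccontr)
    fix p q assume pq: "p \<in> P" "q \<in> P" "f p = f q" "p \<noteq> q"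
    then have "dist p q \<le> diameter (f p)"
      using F(1) f by (intro diameter_bounded_bound) auto
    also have "\<dots> \<le> \<epsilon>" using F(1) f pq(1) by blast
    finally show False using P(2) pq by fastforce
  qed
  then have "card P \<le> card F"
    using F f by (intro card_inj_on_le) auto
  then show ?thesis using F by simp
qed

section \<open>Box dimension from power bounds on covering numbers\<close>

lemma tendsto_ln_powr_over_ln:
  fixes C s :: real
  assumes "0 < C"
  shows "((\<lambda>\<epsilon>. ln (C * \<epsilon> powr - s) / ln (1 / \<epsilon>)) \<longlongrightarrow> s) (at_right 0)"
proof -
  \<comment> \<open>The logarithm splits the quotient into
    \<open>ln C / ln (1 / \<epsilon>)\<close>, which vanishes in the limit, and the constant
    \<open>s\<close>.\<close>
  have "((\<lambda>\<epsilon>. ln C / ln (1 / \<epsilon>) + s) \<longlongrightarrow> 0 + s) (at_right 0)"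
  proof (intro tendsto_intros tendsto_divide_0[OF tendsto_const])
    have "filterlim (\<lambda>\<epsilon>::real. ln (inverse \<epsilon>)) at_top (at_right 0)"
      by (rule filterlim_compose[OF ln_at_top filterlim_inverse_at_top_right])
    then show "filterlim (\<lambda>\<epsilon>::real. ln (1 / \<epsilon>)) at_infinity (at_right 0)"
      by (intro filterlim_at_top_imp_at_infinity) (simp add: inverse_eq_divide)
  qed
  moreover have "eventually (\<lambda>\<epsilon>. ln C / ln (1 / \<epsilon>) + s = ln (C * \<epsilon> powr - s) / ln (1 / \<epsilon>)) (at_right 0)"
    unfolding eventually_at_right_field
  proof (intro exI[of _ 1] conjI allI impI)
    fix y :: real assume y: "0 < y" "y < 1"
    then have "ln y < 0" by simp
    then show "ln C / ln (1 / y) + s = ln (C * y powr - s) / ln (1 / y)"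
      using y assms by (simp add: ln_mult ln_div field_simps)
  qed simp
  ultimately show ?thesis
    using Lim_transform_eventually by fastforce
qed

lemma upper_box_dim_le:
  assumes "1 \<le> C" "0 \<le> s" "0 < r"
    and N: "\<And>\<epsilon>. 0 < \<epsilon> \<Longrightarrow> \<epsilon> < r \<Longrightarrow> real (covering_number \<epsilon> E) \<le> C * \<epsilon> powr - s"
  shows "upper_box_dim E \<le> ereal s"
proof -
  have "eventually (\<lambda>\<epsilon>. ereal (ln (real (covering_number \<epsilon> E)) / ln (1 / \<epsilon>)) \<le>
      ereal (ln (C * \<epsilon> powr - s) / ln (1 / \<epsilon>))) (at_right 0)"
    unfolding eventually_at_right_field
  proof (intro exI[of _ "min 1 r"] conjI allI impI)
    fix y :: real assume y: "0 < y" "y < min 1 r"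
    \<comment> \<open>The bound 1 makes the right-hand logarithm non-negative. This settles the case
      of covering number 0 (empty \<open>E\<close>), where \<open>ln 0 = 0\<close>.\<close>
    have "1 * 1 \<le> C * y powr - s"
    proof (rule mult_mono)
      have "y powr s \<le> 1" "0 < y powr s" using assms y by (auto intro: powr_le1)
      then show "1 \<le> y powr - s" by (simp add: powr_minus one_le_inverse)
    qed (use assms in auto)
    then have "ln (real (covering_number y E)) \<le> ln (C * y powr - s)"
      using N[of y] y by (cases "covering_number y E = 0") auto
    then show "ereal (ln (real (covering_number y E)) / ln (1 / y)) \<le>
      ereal (ln (C * y powr - s) / ln (1 / y))"
      using y by (simp add: divide_right_mono)
  qed (use assms in simp)
  then have "upper_box_dim E \<le> Limsup (at_right 0) (\<lambda>\<epsilon>. ereal (ln (C * \<epsilon> powr - s) / ln (1 / \<epsilon>)))"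
    unfolding upper_box_dim_def by (rule Limsup_mono)
  also have "\<dots> = ereal s"
    using assms by (intro lim_imp_Limsup tendsto_ereal tendsto_ln_powr_over_ln) auto
  finally show ?thesis .
qed

lemma upper_box_dim_ge:
  assumes "0 < C" "0 < r"
    and N: "\<And>\<epsilon>. 0 < \<epsilon> \<Longrightarrow> \<epsilon> < r \<Longrightarrow> C * \<epsilon> powr - s \<le> real (covering_number \<epsilon> E)"
  shows "ereal s \<le> upper_box_dim E"
proof -
  have "eventually (\<lambda>\<epsilon>. ereal (ln (C * \<epsilon> powr - s) / ln (1 / \<epsilon>)) \<le>
      ereal (ln (real (covering_number \<epsilon> E)) / ln (1 / \<epsilon>))) (at_right 0)"
    unfolding eventually_at_right_field
  proof (intro exI[of _ "min 1 r"] conjI allI impI)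
    fix y :: real assume y: "0 < y" "y < min 1 r"
    have "0 < C * y powr - s" using assms y by simp
    then have "ln (C * y powr - s) \<le> ln (real (covering_number y E))"
      using N[of y] y by (subst ln_le_cancel_iff) auto
    then show "ereal (ln (C * y powr - s) / ln (1 / y)) \<le>
      ereal (ln (real (covering_number y E)) / ln (1 / y))"
      using y by (simp add: divide_right_mono)
  qed (use assms in simp)
  then have "Limsup (at_right 0) (\<lambda>\<epsilon>. ereal (ln (C * \<epsilon> powr - s) / ln (1 / \<epsilon>))) \<le> upper_box_dim E"
    unfolding upper_box_dim_def by (rule Limsup_mono)
  moreover have "Limsup (at_right 0) (\<lambda>\<epsilon>. ereal (ln (C * \<epsilon> powr - s) / ln (1 / \<epsilon>))) = ereal s"
    using assms by (intro lim_imp_Limsup tendsto_ereal tendsto_ln_powr_over_ln) auto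
  ultimately show ?thesis by simp
qed

text \<open>The infimum over radii is bounded by its value at radius 1; \<open>0 \<le> s\<close>
  handles the default value 0 off the closure.\<close>

lemma pbox_dim_le:
  assumes "upper_box_dim (E \<inter> ball x 1) \<le> s" "0 \<le> s"
  shows "pbox_dim E x \<le> s"
proof -
  have "(INF r\<in>{0<..}. upper_box_dim (E \<inter> ball x r)) \<le> upper_box_dim (E \<inter> ball x 1)"
    by (rule INF_lower) simp
  then show ?thesis using assms by (auto simp: pbox_dim_def)
qed

section \<open>Lipschitz curves and segments\<close>

text \<open>Cutting the parameter interval into about \<open>L * \<delta> / \<epsilon>\<close> equal
  pieces makes each image piece of diameter at most \<epsilon>, so covering numbers grow at most
  like \<open>1 / \<epsilon>\<close>.\<close>

lemma upper_box_dim_lipschitz_image_le: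
  fixes g :: "real \<Rightarrow> 'a::euclidean_space"
  assumes L: "L-lipschitz_on {0..\<delta>} g" and "0 < \<delta>" and E: "E \<subseteq> g ` {0..\<delta>}"
  shows "upper_box_dim E \<le> 1"
proof -
  have L0: "0 \<le> L" using L by (rule lipschitz_on_nonneg)
  have "upper_box_dim E \<le> ereal 1"
  proof (rule upper_box_dim_le[of "L * \<delta> + 2" 1 1])
    fix \<epsilon> :: real assume \<epsilon>: "0 < \<epsilon>" "\<epsilon> < 1"
    \<comment> \<open>\<open>Suc\<close> keeps \<open>n\<close> positive even when
      \<open>L = 0\<close>, at the price of the additive 2 in the upper bound for
      \<open>n\<close>.\<close>
    define n where "n = Suc (nat \<lceil>L * \<delta> / \<epsilon>\<rceil>)"
    define J where "J i = {real i * \<delta> / n .. real (Suc i) * \<delta> / n}" for i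
    have n: "L * \<delta> / \<epsilon> \<le> real n" "real n \<le> L * \<delta> / \<epsilon> + 2" "0 < n"
    proof -
      have "0 \<le> L * \<delta> / \<epsilon>" using L0 \<epsilon> assms by simp
      then have "0 \<le> \<lceil>L * \<delta> / \<epsilon>\<rceil>" by linarith
      then have "real n = of_int \<lceil>L * \<delta> / \<epsilon>\<rceil> + 1" by (simp add: n_def)
      then show "L * \<delta> / \<epsilon> \<le> real n" "real n \<le> L * \<delta> / \<epsilon> + 2" by linarith+
    qed (simp add: n_def)
    have Jsub: "J i \<subseteq> {0..\<delta>}" if "i < n" for i
    proof -
      have "real (Suc i) * \<delta> \<le> real n * \<delta>"
        using that \<open>0 < \<delta>\<close> by (intro mult_right_mono) auto
      then have "real (Suc i) * \<delta> / n \<le> \<delta>" using n by (simp add: field_simps)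
      then show ?thesis using \<open>0 < \<delta>\<close> by (auto simp: J_def intro: order_trans[rotated])
    qed
    have cover: "{0..\<delta>} \<subseteq> (\<Union>i<n. J i)"
    proof
      fix t assume t: "t \<in> {0..\<delta>}"
      \<comment> \<open>The right endpoint is separate: rounding down would give it the index
        \<open>n\<close>, one too large.\<close>
      show "t \<in> (\<Union>i<n. J i)"
      proof (cases "t = \<delta>")
        case True
        then have "t \<in> J (n - 1)" using n \<open>0 < \<delta>\<close> by (auto simp: J_def field_simps)
        then show ?thesis using n by force
      next
        case False
        define i where "i = nat \<lfloor>t * n / \<delta>\<rfloor>"
        have "0 \<le> t * n / \<delta>" using t \<open>0 < \<delta>\<close> by simp
        then have i: "real i \<le> t * n / \<delta>" "t * n / \<delta> < real i + 1"
          unfolding i_def by linarith+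
        have "t * n / \<delta> < n" using t False \<open>0 < \<delta>\<close> n by (simp add: field_simps)
        then have "i < n" using i by linarith
        moreover have "t \<in> J i" using i \<open>0 < \<delta>\<close> n by (auto simp: J_def field_simps)
        ultimately show ?thesis by blast
      qed
    qed
    have "covering_number \<epsilon> E \<le> card ((\<lambda>i. g ` J i) ` {..<n})"
    proof (rule covering_number_le)
      show "E \<subseteq> \<Union> ((\<lambda>i. g ` J i) ` {..<n})"
        using order_trans[OF E image_mono[OF cover]] by (simp only: image_UN)
      fix U assume "U \<in> (\<lambda>i. g ` J i) ` {..<n}"
      then obtain i where i: "i < n" "U = g ` J i" by auto
      have Li: "L-lipschitz_on (J i) g" using L Jsub[OF i(1)] by (rule lipschitz_on_subset)
      have len: "L * (\<delta> / n) \<le> \<epsilon>" using n \<epsilon> by (simp add: field_simps)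
      have "diameter U \<le> \<epsilon>"
        unfolding i(2)
      proof (rule diameter_le)
        have "J i \<noteq> {}" using n \<open>0 < \<delta>\<close> by (auto simp: J_def divide_right_mono)
        then show "g ` J i \<noteq> {} \<or> 0 \<le> \<epsilon>" by simp
        fix p q assume "p \<in> g ` J i" "q \<in> g ` J i"
        then obtain a b where ab: "a \<in> J i" "b \<in> J i" "p = g a" "q = g b" by auto
        have "dist a b \<le> real (Suc i) * \<delta> / n - real i * \<delta> / n"
          using ab by (auto simp: J_def dist_real_def)
        also have "\<dots> = \<delta> / n" by (simp add: algebra_simps add_divide_distrib)
        finally have "L * dist a b \<le> L * (\<delta> / n)" using L0 by (rule mult_left_mono)
        then show "norm (p - q) \<le> \<epsilon>"
          using lipschitz_onD[OF Li ab(1,2)] ab len by (simp add: dist_norm)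
      qed
      moreover have "bounded U"
        unfolding i(2) using Li
        by (intro bounded_uniformly_continuous_image lipschitz_on_uniformly_continuous) (auto simp: J_def)
      ultimately show "bounded U \<and> diameter U \<le> \<epsilon>" by simp
    qed simp
    also have "\<dots> \<le> n" using card_image_le[of "{..<n}"] by auto
    finally have "real (covering_number \<epsilon> E) \<le> L * \<delta> / \<epsilon> + 2" using n by linarith
    \<comment> \<open>Here \<open>\<epsilon> < 1\<close> absorbs the additive 2 into the multiple of
      \<open>1 / \<epsilon>\<close>.\<close>
    also have "\<dots> \<le> (L * \<delta> + 2) / \<epsilon>" using \<epsilon> by (simp add: field_simps)
    finally show "real (covering_number \<epsilon> E) \<le> (L * \<delta> + 2) * \<epsilon> powr - 1"
      using \<epsilon> by (simp add: powr_minus field_simps)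
  qed (use L0 assms in auto)
  then show ?thesis by (simp add: one_ereal_def)
qed

text \<open>In every ball around \<open>x\<close> a piece of the segment of some length
  \<open>c\<close> survives, and it carries more than \<open>c / (2 * \<epsilon>)\<close> points at
  mutual distance greater than \<epsilon>.\<close>

lemma pbox_dim_segment_ge:
  fixes x v :: "'a::euclidean_space"
  assumes v: "norm v = 1" and "0 < \<delta>" and E: "\<And>t. 0 \<le> t \<Longrightarrow> t \<le> \<delta> \<Longrightarrow> x + t *\<^sub>R v \<in> E"
  shows "1 \<le> pbox_dim E x"
proof -
  have "x \<in> E" using E[of 0] \<open>0 < \<delta>\<close> by simp
  then have cl: "x \<in> closure E" using closure_subset by blast
  have "1 \<le> upper_box_dim (E \<inter> ball x r)" if "0 < r" for r
  proof -
    \<comment> \<open>Halving \<open>r\<close> gives \<open>c < r\<close>, so that even the far end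
      of the piece lies in the open ball.\<close>
    define c where "c = min \<delta> (r / 2)"
    have c: "0 < c" "c \<le> \<delta>" "c < r" using that \<open>0 < \<delta>\<close> by (auto simp: c_def)
    have "ereal 1 \<le> upper_box_dim (E \<inter> ball x r)"
    proof (rule upper_box_dim_ge[of "c/2" 1])
      fix \<epsilon> :: real assume \<epsilon>: "0 < \<epsilon>" "\<epsilon> < 1"
      define n where "n = nat \<lfloor>c / (2 * \<epsilon>)\<rfloor>"
      have "0 \<le> c / (2 * \<epsilon>)" using \<epsilon> c by simp
      then have n: "real n \<le> c / (2 * \<epsilon>)" "c / (2 * \<epsilon>) < real n + 1"
        unfolding n_def by linarith+
      \<comment> \<open>Spacing \<open>2 * \<epsilon>\<close> makes the separation strictly larger
        than \<epsilon>.\<close>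
      define h where "h i = x + (2 * \<epsilon> * real i) *\<^sub>R v" for i :: nat
      have dh: "dist (h i) (h j) = 2 * \<epsilon> * \<bar>real i - real j\<bar>" for i j
      proof -
        have "h i - h j = (2 * \<epsilon> * (real i - real j)) *\<^sub>R v"
          by (simp add: h_def algebra_simps)
        then show ?thesis using v \<epsilon> by (simp add: dist_norm abs_mult)
      qed
      have sep: "\<epsilon> < dist (h i) (h j)" if "i \<noteq> j" for i j
      proof -
        have "1 \<le> \<bar>real i - real j\<bar>" using that by linarith
        then have "2 * \<epsilon> * 1 \<le> 2 * \<epsilon> * \<bar>real i - real j\<bar>" using \<epsilon> by (intro mult_left_mono) auto
        then show ?thesis using \<epsilon> unfolding dh by linarith
      qed
      have "inj h" using sep \<epsilon> by (intro injI) (metis dist_self order_less_asym)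
      have "h ` {..n} \<subseteq> E \<inter> ball x r"
      proof
        fix p assume "p \<in> h ` {..n}"
        then obtain i where i: "i \<le> n" "p = h i" by auto
        have "2 * \<epsilon> * real i \<le> 2 * \<epsilon> * real n" using i \<epsilon> by simp
        also have "\<dots> \<le> c" using n \<epsilon> by (simp add: field_simps)
        finally have "2 * \<epsilon> * real i \<le> c" .
        then show "p \<in> E \<inter> ball x r"
          using E[of "2 * \<epsilon> * real i"] c \<epsilon> v by (simp add: i h_def dist_norm)
      qed
      then have "card (h ` {..n}) \<le> covering_number \<epsilon> (E \<inter> ball x r)"
      proof (intro card_le_covering_number)
        show "bounded (E \<inter> ball x r)" using bounded_subset[OF bounded_ball] by blast
        fix p q assume "p \<in> h ` {..n}" "q \<in> h ` {..n}" "p \<noteq> q"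
        then obtain i j where "p = h i" "q = h j" "i \<noteq> j" by (elim imageE) metis
        then show "\<epsilon> < dist p q" using sep by simp
      qed (use \<epsilon> in auto)
      \<comment> \<open>Counting both ends gives \<open>n + 1\<close> points, which exceeds
        \<open>c / (2 * \<epsilon>)\<close> despite the rounding in \<open>n\<close>.\<close>
      moreover have "card (h ` {..n}) = Suc n"
        using \<open>inj h\<close> by (subst card_image) (auto intro: inj_on_subset)
      ultimately have "c / (2 * \<epsilon>) \<le> real (covering_number \<epsilon> (E \<inter> ball x r))"
        using n by linarith
      then show "c / 2 * \<epsilon> powr - 1 \<le> real (covering_number \<epsilon> (E \<inter> ball x r))"
        using \<epsilon> by (simp add: powr_minus field_simps)
    qed (use c in auto)
    then show ?thesis by (simp add: one_ereal_def)
  qed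
  then show ?thesis using cl by (auto simp: pbox_dim_def intro: INF_greatest)
qed


section \<open>Directional contributions\<close>

text \<open>Whatever \<open>A\<close> is, a probe meets it inside a Lipschitz curve. An empty
  supremum would be the least element of \<open>ereal\<close>, so it obeys the bound too.\<close>

lemma dir_contrib_le_1: "dir_contrib A x v \<le> 1"
  unfolding dir_contrib_def
proof (rule SUP_least, clarify)
  fix \<delta> g assume "(\<delta>, g) \<in> probes A x v"
  then obtain L where "0 < \<delta>" "L-lipschitz_on {0..\<delta>} g" by (auto simp: probes_def)
  then show "pbox_dim (A \<inter> g ` {0..\<delta>}) x \<le> 1"
    by (intro pbox_dim_le upper_box_dim_lipschitz_image_le) auto
qed

lemma proj_contrib_le_1: "proj_contrib A x \<xi> \<le> 1"
  unfolding proj_contrib_def by (intro SUP_least dir_contrib_le_1)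

lemma cross_dim_le: "cross_dim (A :: 'a::euclidean_space set) x \<le> ereal (DIM('a))"
  unfolding cross_dim_def
proof (rule SUP_least, clarify)
  fix m :: nat and \<xi> :: "nat \<Rightarrow> 'a set" assume m: "m \<le> DIM('a)"
  have "(\<Sum>i<m. proj_contrib A x (\<xi> i)) \<le> (\<Sum>i<m. ereal 1)"
    by (rule sum_mono) (simp add: proj_contrib_le_1 flip: one_ereal_def)
  also have "\<dots> \<le> ereal (DIM('a))" using m by (simp only: sum_ereal) simp
  finally show "(\<Sum>i<m. proj_contrib A x (\<xi> i)) \<le> ereal (DIM('a))" .
qed

section \<open>Contribution of a segment issuing from a point\<close>

context
  fixes A :: "'a::euclidean_space set" and x v :: 'a and s :: real
  assumes v: "norm v = 1" and s: "0 < s"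
    and segment: "\<And>t. 0 \<le> t \<Longrightarrow> t \<le> s \<Longrightarrow> x + t *\<^sub>R v \<in> A"
begin

lemma segment_eff_dir: "v \<in> eff_dirs A x"
proof -
  have "x \<in> A" using segment[of 0] s by simp
  then have "x \<in> closure A" using closure_subset by blast
  moreover have "v \<in> tangent_cone A x"
    unfolding tangent_cone_def
  proof (rule CollectI, intro exI conjI allI)
    \<comment> \<open>The scales \<open>s / (k + 1)\<close> decrease to 0 and stay within the
      segment; with them the difference quotients are constantly \<open>v\<close>.\<close>
    let ?l = "\<lambda>k. s * inverse (real (Suc k))"
    have lim: "?l \<longlonglongrightarrow> 0"
      using tendsto_mult_right_zero[OF LIMSEQ_inverse_real_of_nat] .
    show "?l \<longlonglongrightarrow> 0" by (rule lim)
    show "decseq ?l" using s by (intro decseq_SucI) (simp add: field_simps)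
    show "0 < ?l k" for k using s by simp
    show "x + ?l k *\<^sub>R v \<in> A" for k
      using s by (intro segment) (auto simp: field_simps)
    show "(\<lambda>k. x + ?l k *\<^sub>R v) \<longlonglongrightarrow> x"
      using tendsto_add[OF tendsto_const tendsto_scaleR[OF lim tendsto_const], of x v] by simp
    show "(\<lambda>k. (x + ?l k *\<^sub>R v - x) /\<^sub>R ?l k) \<longlonglongrightarrow> v"
    proof -
      have "(x + c *\<^sub>R v - x) /\<^sub>R c = v" if "c \<noteq> 0" for c :: real using that by simp
      then have "(x + ?l k *\<^sub>R v - x) /\<^sub>R ?l k = v" for k
        using s by (metis mult_eq_0_iff inverse_nonzero_iff_nonzero of_nat_neq_0 less_irrefl)
      then show ?thesis by simp
    qed
  qed
  ultimately show ?thesis using v by (simp add: eff_dirs_def)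
qed

text \<open>The segment itself, parametrised by arc length, is an admissible probe, and its
  intersection with \<open>A\<close> is the whole segment.\<close>

lemma segment_dir_contrib: "1 \<le> dir_contrib A x v"
proof -
  let ?g = "\<lambda>t. x + t *\<^sub>R v"
  have "v \<noteq> 0" using v by auto
  have "eventually (\<lambda>t. v = (?g t - x) /\<^sub>R norm (?g t - x)) (at_right 0)"
    using v by (auto simp: eventually_at_right_field intro!: exI[of _ 1])
  then have "((\<lambda>t. (?g t - x) /\<^sub>R norm (?g t - x)) \<longlongrightarrow> v) (at_right 0)"
    by (rule Lim_transform_eventually[OF tendsto_const])
  moreover have "1-lipschitz_on {0..s} ?g"
    using v by (intro lipschitz_onI) (simp_all add: dist_norm flip: scaleR_diff_left)
  moreover have "A \<inter> ?g ` {0<..\<eta>} \<noteq> {}" if "0 < \<eta>" "\<eta> \<le> s" for \<eta>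
  proof -
    have "?g \<eta> \<in> ?g ` {0<..\<eta>}" using that(1) by (intro imageI) simp
    moreover have "?g \<eta> \<in> A" using segment[of \<eta>] that by simp
    ultimately show ?thesis by blast
  qed
  ultimately have "(s, ?g) \<in> probes A x v"
    using s \<open>v \<noteq> 0\<close> by (auto simp: probes_def inj_on_def)
  moreover have "1 \<le> pbox_dim (A \<inter> ?g ` {0..s}) x"
    by (rule pbox_dim_segment_ge[OF v s]) (use segment in auto)
  ultimately show ?thesis
    unfolding dir_contrib_def by (intro SUP_upper2) auto
qed

lemma segment_proj_contrib: "span {v} \<in> proj_eff_dirs A x" "1 \<le> proj_contrib A x (span {v})"
  unfolding proj_eff_dirs_def proj_contrib_def
  using segment_eff_dir segment_dir_contrib by (auto intro: SUP_upper2)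

end


section \<open>Cells of the carpet\<close>

lemma pt_add: "pt a b + pt c d = pt (a + c) (b + d)"
  and pt_scaleR: "r *\<^sub>R pt a b = pt (r * a) (r * b)"
  and pt_0: "pt 0 0 = 0"
  by (simp_all add: vec_eq_iff forall_2)

lemma finite_carpet_digits: "finite carpet_digits"
  by (simp add: carpet_digits_def)

lemma card_carpet_digits: "card carpet_digits = 8"
  by (simp add: carpet_digits_def card_Diff_subset card_cartesian_product)

lemma compact_carpet: "compact carpet" and carpet_step_carpet: "carpet_step carpet = carpet"
  and carpet_nonempty: "carpet \<noteq> {}"
  using carpet_props by auto

lemma carpet_sub: assumes "(i, j) \<in> carpet_digits" "p \<in> carpet"
  shows "(p + pt (real i) (real j)) /\<^sub>R 3 \<in> carpet"
  using assms carpet_step_carpet unfolding carpet_step_def by blast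

text \<open>A coordinate attains its maximum \<open>M\<close> and minimum \<open>m\<close> on the
  compact carpet. Self-similarity writes each coordinate value as \<open>(q $ i + d) / 3\<close>
  with \<open>d\<close> between 0 and 2, so \<open>M \<le> (M + 2) / 3\<close> and
  \<open>m \<ge> m / 3\<close>.\<close>

lemma carpet_bounds:
  assumes "p \<in> carpet" shows "0 \<le> p $ i" "p $ i \<le> 1"
proof -
  have cont: "continuous_on carpet (\<lambda>p. p $ i)" by (intro continuous_intros)
  obtain u where u: "u \<in> carpet" "\<And>q. q \<in> carpet \<Longrightarrow> q $ i \<le> u $ i"
    using continuous_attains_sup[OF compact_carpet carpet_nonempty cont] by blast
  obtain l where l: "l \<in> carpet" "\<And>q. q \<in> carpet \<Longrightarrow> l $ i \<le> q $ i"
    using continuous_attains_inf[OF compact_carpet carpet_nonempty cont] by blast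
  have digit: "\<exists>q\<in>carpet. \<exists>d. 0 \<le> d \<and> d \<le> 2 \<and> p $ i = (q $ i + d) / 3" if "p \<in> carpet" for p
  proof -
    have "p \<in> carpet_step carpet" using that by (simp only: carpet_step_carpet)
    then obtain a b q where *: "(a, b) \<in> carpet_digits" "q \<in> carpet" "p = (q + pt (real a) (real b)) /\<^sub>R 3"
      unfolding carpet_step_def by auto
    then have "p $ i = (q $ i + pt (real a) (real b) $ i) / 3" by simp
    moreover have "0 \<le> pt (real a) (real b) $ i \<and> pt (real a) (real b) $ i \<le> 2"
      using *(1) exhaust_2[of i] by (auto simp: carpet_digits_def)
    ultimately show ?thesis using *(2) by blast
  qed
  have "u $ i \<le> 1" using digit[OF u(1)] u(2) by force
  then show "p $ i \<le> 1" using u assms by force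
  have "0 \<le> l $ i" using digit[OF l(1)] l(2) by force
  then show "0 \<le> p $ i" using l assms by force
qed

lemma dist_carpet_le:
  assumes "p \<in> carpet" "q \<in> carpet" shows "dist p q \<le> 2"
proof -
  have "norm (p - q) \<le> (\<Sum>i\<in>UNIV. \<bar>(p - q) $ i\<bar>)" by (rule norm_le_l1_cart)
  also have "\<dots> \<le> (\<Sum>i\<in>(UNIV :: 2 set). 1)"
  proof (rule sum_mono)
    fix i :: 2
    show "\<bar>(p - q) $ i\<bar> \<le> 1" using carpet_bounds[of _ i] assms by (force simp: abs_le_iff)
  qed
  finally show ?thesis by (simp add: dist_norm)
qed

lemma dist_inverse_scaleR:
  fixes p q :: "'a::real_normed_vector"
  assumes "0 < c"
  shows "dist (p /\<^sub>R c) (q /\<^sub>R c) = dist p q / c"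
  using assms by (simp add: dist_norm divide_inverse mult.commute flip: scaleR_diff_right)

text \<open>The set \<open>B\<close> is a parameter so that cells can be formed both from the carpet
  and from sets only known to satisfy \<open>B \<subseteq> carpet_step B\<close>.\<close>

definition cell :: "(real ^ 2) set \<Rightarrow> nat \<Rightarrow> real ^ 2 \<Rightarrow> (real ^ 2) set" where
  "cell B k a = (\<lambda>p. a + p /\<^sub>R 3 ^ k) ` B"

lemma cells_cover:
  assumes "B \<subseteq> carpet_step B"
  shows "B \<subseteq> (\<Union>a\<in>carpet_cells k. cell B k a)"
proof (induction k)
  case 0
  show ?case by (simp add: cell_def)
next
  case (Suc k)
  show ?case
  proof
    fix p assume "p \<in> B"
    with Suc obtain a q where a: "a \<in> carpet_cells k" "q \<in> B" "p = a + q /\<^sub>R 3 ^ k"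
      unfolding cell_def by blast
    obtain i j q' where d: "(i, j) \<in> carpet_digits" "q' \<in> B" "q = (q' + pt (real i) (real j)) /\<^sub>R 3"
      using a(2) assms unfolding carpet_step_def by blast
    \<comment> \<open>The digit pair of \<open>q\<close> becomes the next pair of ternary digits of
      the corner.\<close>
    have "p = (a + pt (real i) (real j) /\<^sub>R 3 ^ Suc k) + q' /\<^sub>R 3 ^ Suc k"
      unfolding a d by (simp add: scaleR_add_right algebra_simps)
    moreover have "a + pt (real i) (real j) /\<^sub>R 3 ^ Suc k \<in> carpet_cells (Suc k)"
      using a d by auto
    ultimately show "p \<in> (\<Union>a\<in>carpet_cells (Suc k). cell B (Suc k) a)"
      using d unfolding cell_def by blast
  qed
qed

text \<open>A cell lies in its parent cell, because each digit map sends the carpet into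
  itself.\<close>

lemma cell_subset_carpet: "a \<in> carpet_cells k \<Longrightarrow> cell carpet k a \<subseteq> carpet"
proof (induction k arbitrary: a)
  case 0
  then show ?case by (simp add: cell_def)
next
  case (Suc k)
  then obtain b i j where b: "b \<in> carpet_cells k" "(i, j) \<in> carpet_digits"
    "a = b + pt (real i) (real j) /\<^sub>R 3 ^ Suc k" by auto
  show ?case
  proof
    fix p assume "p \<in> cell carpet (Suc k) a"
    then obtain q where q: "q \<in> carpet" "p = a + q /\<^sub>R 3 ^ Suc k" by (auto simp: cell_def)
    have "p = b + ((q + pt (real i) (real j)) /\<^sub>R 3) /\<^sub>R 3 ^ k"
      unfolding b q by (simp add: scaleR_add_right algebra_simps)
    then have "p \<in> cell carpet k b"
      unfolding cell_def using carpet_sub[OF b(2) q(1)] by blast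
    then show "p \<in> carpet" using Suc.IH b by blast
  qed
qed

lemma carpet_eq_cells: "carpet = (\<Union>a\<in>carpet_cells k. cell carpet k a)"
  using cells_cover[of carpet k] cell_subset_carpet carpet_step_carpet by blast

lemma dist_cell_le: assumes "p \<in> cell carpet k a" "q \<in> cell carpet k a"
  shows "dist p q \<le> 2 / 3 ^ k"
proof -
  obtain p' q' where *: "p' \<in> carpet" "q' \<in> carpet" "p = a + p' /\<^sub>R 3 ^ k" "q = a + q' /\<^sub>R 3 ^ k"
    using assms by (auto simp: cell_def)
  have "dist p q = dist p' q' / 3 ^ k"
    unfolding * by (simp add: dist_inverse_scaleR)
  then show ?thesis using dist_carpet_le[OF *(1,2)] by (simp add: divide_right_mono)
qed

lemma small_power_3: assumes "0 < (e::real)" shows "\<exists>k. 2 / 3 ^ k < e"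
proof -
  obtain n where "2 / e < 3 ^ n" using real_arch_pow[of 3 "2 / e"] by auto
  then show ?thesis using assms by (intro exI[of _ n]) (simp add: field_simps)
qed

text \<open>A point of \<open>B\<close> lies in a cell of \<open>B\<close> at every stage. The cell
  of the carpet at the same corner is within \<open>D / 3 ^ n\<close> of it, so the point is a limit
  of points of the closed carpet.\<close>

lemma subset_carpetI:
  assumes B: "bounded B" "B \<subseteq> carpet_step B"
  shows "B \<subseteq> carpet"
proof
  fix p assume p: "p \<in> B"
  obtain c where c: "c \<in> carpet" using carpet_nonempty by blast
  have "bounded (B \<union> carpet)" using B compact_imp_bounded[OF compact_carpet] by simp
  then obtain D where D: "\<And>y z. y \<in> B \<union> carpet \<Longrightarrow> z \<in> B \<union> carpet \<Longrightarrow> dist y z \<le> D"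
    using bounded_two_points by metis
  have "p \<in> closure carpet"
    unfolding closure_approachable
  proof (intro allI impI)
    fix e :: real assume "0 < e"
    obtain n where "D / e < 3 ^ n"
      using real_arch_pow[of 3 "D / e"] by auto
    with \<open>0 < e\<close> have n: "D / 3 ^ n < e"
      by (simp add: pos_divide_less_eq mult.commute)
    obtain a q where a: "a \<in> carpet_cells n" "q \<in> B" "p = a + q /\<^sub>R 3 ^ n"
      using cells_cover[OF B(2), of n] p unfolding cell_def by blast
    have "a + c /\<^sub>R 3 ^ n \<in> carpet"
      using cell_subset_carpet[OF a(1)] c unfolding cell_def by blast
    moreover have "dist (a + c /\<^sub>R 3 ^ n) p = dist c q / 3 ^ n"
      unfolding a by (simp add: dist_inverse_scaleR)
    moreover have "\<dots> \<le> D / 3 ^ n" using D c a by (simp add: divide_right_mono)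
    ultimately show "\<exists>y\<in>carpet. dist y p < e" using n by force
  qed
  then show "p \<in> carpet" using compact_carpet by (simp add: compact_imp_closed)
qed

section \<open>The boundary of the unit square\<close>

definition unit_boundary :: "(real ^ 2) set" where
  "unit_boundary = {pt a b | a b. 0 \<le> a \<and> a \<le> 1 \<and> 0 \<le> b \<and> b \<le> 1 \<and> (a \<in> {0, 1} \<or> b \<in> {0, 1})}"

lemma pt_in_unit_boundary_iff:
  "pt a b \<in> unit_boundary \<longleftrightarrow>
    0 \<le> a \<and> a \<le> 1 \<and> 0 \<le> b \<and> b \<le> 1 \<and> (a \<in> {0, 1} \<or> b \<in> {0, 1})"
  unfolding unit_boundary_def by (auto dest: arg_cong[of _ _ "\<lambda>p. p $ 1"] arg_cong[of _ _ "\<lambda>p. p $ 2"])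

text \<open>By \<open>subset_carpetI\<close> it suffices that every boundary point is the image of a
  boundary point under a digit map.\<close>

lemma unit_boundary_subset_carpet: "unit_boundary \<subseteq> carpet"
proof (rule subset_carpetI)
  have "unit_boundary \<subseteq> cbox 0 (pt 1 1)"
    by (auto simp: unit_boundary_def mem_box_cart forall_2)
  then show "bounded unit_boundary" using bounded_cbox bounded_subset by blast
  have third: "\<exists>i. i \<le> 2 \<and> 0 \<le> 3 * t - real i \<and> 3 * t - real i \<le> 1" if "0 \<le> t" "t \<le> 1" for t :: real
  proof -
    consider "3 * t \<le> 1" | "1 \<le> 3 * t" "3 * t \<le> 2" | "2 \<le> 3 * t" by linarith
    then show ?thesis
    proof cases
      case 1 then show ?thesis using that by (intro exI[of _ 0]) auto
    next
      case 2 then show ?thesis using that by (intro exI[of _ 1]) auto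
    next
      case 3 then show ?thesis using that by (intro exI[of _ 2]) auto
    qed
  qed
  have stepI: "pt a b \<in> carpet_step unit_boundary"
    if "(i, j) \<in> carpet_digits" "pt (3 * a - real i) (3 * b - real j) \<in> unit_boundary" for a b i j
  proof -
    have "pt a b = (pt (3 * a - real i) (3 * b - real j) + pt (real i) (real j)) /\<^sub>R 3"
      by (simp add: pt_add pt_scaleR)
    then show ?thesis using that unfolding carpet_step_def by blast
  qed
  show "unit_boundary \<subseteq> carpet_step unit_boundary"
  proof
    fix p assume "p \<in> unit_boundary"
    then obtain a b where p: "p = pt a b" "0 \<le> a" "a \<le> 1" "0 \<le> b" "b \<le> 1" "a \<in> {0, 1} \<or> b \<in> {0, 1}"
      by (auto simp: unit_boundary_def)
    obtain i where i: "i \<le> 2" "0 \<le> 3 * a - real i" "3 * a - real i \<le> 1" using third p by blast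
    obtain j where j: "j \<le> 2" "0 \<le> 3 * b - real j" "3 * b - real j \<le> 1" using third p by blast
    \<comment> \<open>The coordinate that is 0 or 1 takes digit 0 or 2 and keeps its value under
      rescaling. The digit pair is thus never the middle one, and the rescaled point stays on the
      boundary.\<close>
    consider "a = 0" | "a = 1" | "b = 0" | "b = 1" using p by blast
    then show "p \<in> carpet_step unit_boundary"
      unfolding p(1)
    proof cases
      case 1
      then show "pt a b \<in> carpet_step unit_boundary"
        using j by (intro stepI[of 0 j]) (auto simp: carpet_digits_def pt_in_unit_boundary_iff)
    next
      case 2
      then show "pt a b \<in> carpet_step unit_boundary"
        using j by (intro stepI[of 2 j]) (auto simp: carpet_digits_def pt_in_unit_boundary_iff)
    next
      case 3
      then show "pt a b \<in> carpet_step unit_boundary"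
        using i by (intro stepI[of i 0]) (auto simp: carpet_digits_def pt_in_unit_boundary_iff)
    next
      case 4
      then show "pt a b \<in> carpet_step unit_boundary"
        using i by (intro stepI[of i 2]) (auto simp: carpet_digits_def pt_in_unit_boundary_iff)
    qed
  qed
qed

lemma zero_in_carpet: "0 \<in> carpet"
proof -
  have "pt 0 0 \<in> unit_boundary" by (simp add: pt_in_unit_boundary_iff)
  then show ?thesis using unit_boundary_subset_carpet by (auto simp: pt_0)
qed

text \<open>A corner is the image of the origin in its cell. The corners later serve as separated
  points of the carpet.\<close>

lemma carpet_cells_subset_carpet: "carpet_cells k \<subseteq> carpet"
proof
  fix a assume a: "a \<in> carpet_cells k"
  have "a + 0 /\<^sub>R 3 ^ k \<in> cell carpet k a" unfolding cell_def using zero_in_carpet by blast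
  then show "a \<in> carpet" using cell_subset_carpet[OF a] by auto
qed


section \<open>Peripheral squares\<close>

text \<open>Each side of a removed middle square is a side of one of its surviving neighbours.\<close>

lemma removed_square_boundary:
  assumes a: "a \<in> carpet_cells k" and p: "p \<in> unit_boundary"
  shows "a + pt 1 1 /\<^sub>R 3 ^ Suc k + p /\<^sub>R 3 ^ Suc k \<in> carpet"
proof -
  \<comment> \<open>The hypothesis on \<open>q\<close> says that the point at position
    \<open>p\<close> of the middle square is at position \<open>q\<close> of its neighbour with
    digits \<open>(i, j)\<close>.\<close>
  have nb: "a + pt 1 1 /\<^sub>R 3 ^ Suc k + p /\<^sub>R 3 ^ Suc k \<in> carpet"
    if "(i, j) \<in> carpet_digits" "q \<in> unit_boundary" "p + pt 1 1 = q + pt (real i) (real j)" for i j q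
  proof -
    let ?b = "a + pt (real i) (real j) /\<^sub>R 3 ^ Suc k"
    have "?b \<in> carpet_cells (Suc k)" using a that by auto
    then have "?b + q /\<^sub>R 3 ^ Suc k \<in> carpet"
      using cell_subset_carpet that(2) unit_boundary_subset_carpet unfolding cell_def by blast
    moreover have "?b + q /\<^sub>R 3 ^ Suc k = a + (q + pt (real i) (real j)) /\<^sub>R 3 ^ Suc k"
      by (simp only: scaleR_add_right add_ac)
    ultimately show ?thesis
      unfolding that(3)[symmetric] by (simp only: scaleR_add_right add_ac)
  qed
  obtain u w where uw: "p = pt u w" "0 \<le> u" "u \<le> 1" "0 \<le> w" "w \<le> 1" "u \<in> {0, 1} \<or> w \<in> {0, 1}"
    using p by (auto simp: unit_boundary_def)
  \<comment> \<open>The left side of the middle square is the right side of its left neighbour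
    \<open>(0, 1)\<close>; the other three sides are analogous.\<close>
  consider "u = 0" | "u = 1" | "w = 0" | "w = 1" using uw by blast
  then show ?thesis
  proof cases
    case 1
    then show ?thesis using uw
      by (intro nb[of 0 1 "pt 1 w"]) (auto simp: carpet_digits_def pt_in_unit_boundary_iff pt_add)
  next
    case 2
    then show ?thesis using uw
      by (intro nb[of 2 1 "pt 0 w"]) (auto simp: carpet_digits_def pt_in_unit_boundary_iff pt_add)
  next
    case 3
    then show ?thesis using uw
      by (intro nb[of 1 0 "pt u 1"]) (auto simp: carpet_digits_def pt_in_unit_boundary_iff pt_add)
  next
    case 4
    then show ?thesis using uw
      by (intro nb[of 1 2 "pt u 0"]) (auto simp: carpet_digits_def pt_in_unit_boundary_iff pt_add)
  qed
qed

lemma square_vertex_segments: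
  assumes B: "\<And>p. p \<in> unit_boundary \<Longrightarrow> c + s *\<^sub>R p \<in> carpet" and "0 < s"
    and x: "x \<in> square_vertices c s"
  obtains \<sigma> \<tau> where "\<bar>\<sigma>\<bar> = 1" "\<bar>\<tau>\<bar> = 1"
    "\<And>t. 0 \<le> t \<Longrightarrow> t \<le> s \<Longrightarrow> x + t *\<^sub>R pt \<sigma> 0 \<in> carpet"
    "\<And>t. 0 \<le> t \<Longrightarrow> t \<le> s \<Longrightarrow> x + t *\<^sub>R pt 0 \<tau> \<in> carpet"
proof -
  obtain u w where uw: "u \<in> {0, 1}" "w \<in> {0, 1}" "x = c + s *\<^sub>R pt u w"
  proof -
    have "x = c + s *\<^sub>R pt 0 0 \<or> x = c + s *\<^sub>R pt 1 0 \<or> x = c + s *\<^sub>R pt 0 1 \<or> x = c + s *\<^sub>R pt 1 1"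
      using x by (auto simp: square_vertices_def pt_scaleR pt_0)
    then show thesis using that by blast
  qed
  show thesis
  \<comment> \<open>The sign \<open>1 - 2 * u\<close> points from the end \<open>u\<close> of a side
    towards the other end: it is 1 at 0 and -1 at 1.\<close>
  proof (rule that[of "1 - 2 * u" "1 - 2 * w"])
    fix t assume t: "0 \<le> t" "t \<le> s"
    define t' where "t' = t / s"
    have t': "0 \<le> t'" "t' \<le> 1" "t = s * t'" using t \<open>0 < s\<close> by (auto simp: t'_def)
    have "pt (u + t' * (1 - 2 * u)) w \<in> unit_boundary" "pt u (w + t' * (1 - 2 * w)) \<in> unit_boundary"
      using uw t' by (auto simp: pt_in_unit_boundary_iff)
    then show "x + t *\<^sub>R pt (1 - 2 * u) 0 \<in> carpet" "x + t *\<^sub>R pt 0 (1 - 2 * w) \<in> carpet"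
      using B unfolding uw t' by (fastforce simp: pt_scaleR pt_add add.assoc algebra_simps)+
  qed (use uw in auto)
qed

text \<open>The initial square and the removed squares are treated alike, since each has its whole
  boundary in the carpet.\<close>

lemma carpet_vertex_segments:
  assumes "x \<in> carpet_vertices"
  obtains s \<sigma> \<tau> where "0 < s" "\<bar>\<sigma>\<bar> = 1" "\<bar>\<tau>\<bar> = 1"
    "\<And>t. 0 \<le> t \<Longrightarrow> t \<le> s \<Longrightarrow> x + t *\<^sub>R pt \<sigma> 0 \<in> carpet"
    "\<And>t. 0 \<le> t \<Longrightarrow> t \<le> s \<Longrightarrow> x + t *\<^sub>R pt 0 \<tau> \<in> carpet"
proof -
  obtain c s where cs: "0 < s" "x \<in> square_vertices c s" "\<And>p. p \<in> unit_boundary \<Longrightarrow> c + s *\<^sub>R p \<in> carpet"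
  proof -
    consider "x \<in> square_vertices 0 1"
      | k a where "a \<in> carpet_cells k" "x \<in> square_vertices (a + pt 1 1 /\<^sub>R 3 ^ Suc k) (1 / 3 ^ Suc k)"
      using assms unfolding carpet_vertices_def by blast
    then show thesis
    proof cases
      case 1
      then show thesis using that[of 1 0] unit_boundary_subset_carpet by auto
    next
      case 2
      show thesis
      proof (rule that[OF _ 2(2)])
        show "a + pt 1 1 /\<^sub>R 3 ^ Suc k + (1 / 3 ^ Suc k) *\<^sub>R p \<in> carpet" if "p \<in> unit_boundary" for p
          using removed_square_boundary[OF 2(1) that] by (simp only: inverse_eq_divide)
      qed simp
    qed
  qed
  then show thesis using square_vertex_segments[OF cs(3,1,2)] that by metis
qed

lemma carpet_vertices_subset_carpet: "carpet_vertices \<subseteq> carpet"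
proof
  fix x assume "x \<in> carpet_vertices"
  then obtain s \<sigma> where "0 < s" "\<And>t. 0 \<le> t \<Longrightarrow> t \<le> s \<Longrightarrow> x + t *\<^sub>R pt \<sigma> 0 \<in> carpet"
    using carpet_vertex_segments by metis
  from this(2)[of 0] \<open>0 < s\<close> show "x \<in> carpet" by simp
qed

text \<open>Every cell contains a vertex, namely the lower left corner \<open>?y\<close> of its own
  middle square, and cells become arbitrarily small.\<close>

lemma carpet_subset_closure_vertices: "carpet \<subseteq> closure carpet_vertices"
proof
  fix x assume x: "x \<in> carpet"
  show "x \<in> closure carpet_vertices"
    unfolding closure_approachable
  proof (intro allI impI)
    fix e :: real assume "0 < e"
    then obtain k where k: "2 / 3 ^ k < e" using small_power_3 by blast
    obtain a where a: "a \<in> carpet_cells k" "x \<in> cell carpet k a"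
      using x carpet_eq_cells[of k] by blast
    let ?y = "a + pt 1 1 /\<^sub>R 3 ^ Suc k"
    have "pt 0 0 \<in> unit_boundary" by (simp add: pt_in_unit_boundary_iff)
    \<comment> \<open>At stage 0 this corner is the point with both coordinates 1/3; its copy in the
      cell at \<open>a\<close> is \<open>?y\<close>.\<close>
    then have "(pt 0 0 + pt 1 1) /\<^sub>R 3 \<in> carpet"
      using removed_square_boundary[of 0 0 "pt 0 0"] by (simp add: pt_0)
    then have "a + ((pt 0 0 + pt 1 1) /\<^sub>R 3) /\<^sub>R 3 ^ k \<in> cell carpet k a"
      unfolding cell_def by blast
    then have "?y \<in> cell carpet k a" by (simp add: pt_0 mult.commute)
    then have "dist ?y x < e" using dist_cell_le[OF _ a(2)] k by force
    moreover have "?y \<in> carpet_vertices"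
      unfolding carpet_vertices_def square_vertices_def using a(1) by blast
    ultimately show "\<exists>y\<in>carpet_vertices. dist y x < e" by blast
  qed
qed

section \<open>Point-Cross dimension at the vertices\<close>

theorem cross_dim_carpet_vertex:
  assumes "x \<in> carpet_vertices" shows "cross_dim carpet x = 2"
proof (rule antisym)
  show "cross_dim carpet x \<le> 2" using cross_dim_le[of carpet x] by simp
  obtain s \<sigma> \<tau> where *: "0 < s" "\<bar>\<sigma>\<bar> = 1" "\<bar>\<tau>\<bar> = 1"
    "\<And>t. 0 \<le> t \<Longrightarrow> t \<le> s \<Longrightarrow> x + t *\<^sub>R pt \<sigma> 0 \<in> carpet"
    "\<And>t. 0 \<le> t \<Longrightarrow> t \<le> s \<Longrightarrow> x + t *\<^sub>R pt 0 \<tau> \<in> carpet"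
    using carpet_vertex_segments[OF assms] by metis
  \<comment> \<open>The two side directions are indexed by numbers because
    \<open>proj_independent\<close> speaks of families; only the indices 0 and 1 enter.\<close>
  define w where "w i = (if i = 0 then pt \<sigma> 0 else pt 0 \<tau>)" for i :: nat
  have norm: "norm (w i) = 1" for i
    using *(2,3) by (simp add: w_def norm_vec_def L2_set_def sum_2 abs_square_eq_1)
  have seg: "x + t *\<^sub>R w i \<in> carpet" if "0 \<le> t" "t \<le> s" for i t
    using * that by (auto simp: w_def)
  note contrib = segment_proj_contrib[OF norm \<open>0 < s\<close> seg]
  have "w 0 \<noteq> w 1" using * by (auto simp: w_def vec_eq_iff forall_2)
  have "w 0 \<bullet> w 1 = 0" by (simp add: w_def inner_vec_def sum_2)
  then have "independent {w 0, w 1}"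
    using norm[of 0] norm[of 1]
    by (intro pairwise_orthogonal_independent) (auto simp: pairwise_def orthogonal_def inner_commute)
  moreover have two: "{..<2} = {0, 1 :: nat}" by auto
  ultimately have "proj_independent 2 (\<lambda>i. span {w i})"
    unfolding proj_independent_def using norm \<open>w 0 \<noteq> w 1\<close>
    by (intro exI[of _ w]) (auto simp: two, metis norm_zero zero_neq_one)
  then have "(2, \<lambda>i. span {w i}) \<in> {(m, \<xi>). m \<le> DIM(real ^ 2) \<and>
      (\<forall>i<m. \<xi> i \<in> proj_eff_dirs carpet x) \<and> proj_independent m \<xi>}"
    using contrib by simp
  moreover have "2 \<le> (\<Sum>i<2. proj_contrib carpet x (span {w i}))"
  proof -
    have "1 + 1 \<le> proj_contrib carpet x (span {w 0}) + proj_contrib carpet x (span {w 1})"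
      using contrib by (intro add_mono)
    then show ?thesis by (simp add: two)
  qed
  ultimately show "2 \<le> cross_dim carpet x"
    unfolding cross_dim_def
    by (intro SUP_upper2[of "(2, \<lambda>i. span {w i})"]) simp_all
qed


section \<open>Box dimension of the carpet\<close>

text \<open>Let \<open>h\<close> be the new side length. Under one parent, distinct digits differ by
  at least \<open>h\<close> in some coordinate. Distinct parents differ by at least
  \<open>3 * h\<close> in some coordinate, of which the digits cancel at most
  \<open>2 * h\<close>.\<close>

lemma carpet_cells_separated:
  "a \<in> carpet_cells k \<Longrightarrow> b \<in> carpet_cells k \<Longrightarrow> a \<noteq> b \<Longrightarrow> \<exists>i. 1 / 3 ^ k \<le> \<bar>a $ i - b $ i\<bar>"
proof (induction k arbitrary: a b)
  case 0
  then show ?case by simp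
next
  case (Suc k)
  obtain a' i j where a: "a' \<in> carpet_cells k" "(i, j) \<in> carpet_digits"
    "a = a' + pt (real i) (real j) /\<^sub>R 3 ^ Suc k" using Suc.prems by auto
  obtain b' i' j' where b: "b' \<in> carpet_cells k" "(i', j') \<in> carpet_digits"
    "b = b' + pt (real i') (real j') /\<^sub>R 3 ^ Suc k" using Suc.prems by auto
  define h :: real where "h = 1 / 3 ^ Suc k"
  have h: "0 < h" "1 / 3 ^ k = 3 * h" by (auto simp: h_def)
  let ?d = "pt (real i - real i') (real j - real j')"
  have diff: "a $ l - b $ l = (a' $ l - b' $ l) + h * ?d $ l" for l
    using exhaust_2[of l] by (auto simp: a b h_def field_simps)
  show ?case
  proof (cases "a' = b'")
    case True
    then have "i \<noteq> i' \<or> j \<noteq> j'" using a b Suc.prems by auto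
    then have "1 \<le> \<bar>real i - real i'\<bar> \<or> 1 \<le> \<bar>real j - real j'\<bar>" by linarith
    then have "\<exists>l. 1 \<le> \<bar>?d $ l\<bar>" by (metis pt_nth)
    then obtain l where "h * 1 \<le> h * \<bar>?d $ l\<bar>" using h by (meson mult_left_mono less_imp_le)
    then show ?thesis using True diff[of l] h(1) unfolding h_def[symmetric]
      by (intro exI[of _ l]) (simp add: abs_mult)
  next
    case False
    then obtain l where l: "3 * h \<le> \<bar>a' $ l - b' $ l\<bar>" using Suc.IH a b h by metis
    have "\<bar>?d $ l\<bar> \<le> 2" using a(2) b(2) exhaust_2[of l] by (auto simp: carpet_digits_def)
    then have "\<bar>h * ?d $ l\<bar> \<le> h * 2" using h by (simp add: abs_mult)
    then show ?thesis using diff[of l] l unfolding h_def[symmetric]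
      by (intro exI[of _ l]) linarith
  qed
qed

lemma carpet_cells_Suc_image:
  "carpet_cells (Suc k) = (\<lambda>(a, i, j). a + pt (real i) (real j) /\<^sub>R 3 ^ Suc k) ` (carpet_cells k \<times> carpet_digits)"
  by force

lemma finite_carpet_cells: "finite (carpet_cells k)"
  by (induction k) (simp_all only: carpet_cells_Suc_image finite_imageI finite_cartesian_product
      finite_carpet_digits carpet_cells.simps(1) finite.intros)

lemma card_carpet_cells: "card (carpet_cells k) = 8 ^ k"
proof (induction k)
  case 0
  show ?case by simp
next
  case (Suc k)
  have "inj_on (\<lambda>(a, i, j). a + pt (real i) (real j) /\<^sub>R 3 ^ Suc k) (carpet_cells k \<times> carpet_digits)"
  proof (rule inj_onI, clarify)
    fix a i j b i' j'
    assume a: "a \<in> carpet_cells k" "(i, j) \<in> carpet_digits"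
      and b: "b \<in> carpet_cells k" "(i', j') \<in> carpet_digits"
      and eq: "a + pt (real i) (real j) /\<^sub>R 3 ^ Suc k = b + pt (real i') (real j') /\<^sub>R 3 ^ Suc k"
    define h :: real where "h = 1 / 3 ^ Suc k"
    have h: "0 < h" "1 / 3 ^ k = 3 * h" by (auto simp: h_def)
    let ?d = "pt (real i' - real i) (real j' - real j)"
    have diff: "a $ l - b $ l = h * ?d $ l" for l
      using arg_cong[OF eq, of "\<lambda>p. p $ l"] exhaust_2[of l] by (auto simp: h_def field_simps)
    \<comment> \<open>Equal new corners would force the parents to be within \<open>2 * h\<close> in
      each coordinate, against their separation \<open>3 * h\<close>.\<close>
    have "a = b"
    proof (rule ccontr)
      assume "a \<noteq> b"
      then obtain l where l: "3 * h \<le> \<bar>a $ l - b $ l\<bar>"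
        using carpet_cells_separated a b h by metis
      have "\<bar>?d $ l\<bar> \<le> 2" using a(2) b(2) exhaust_2[of l] by (auto simp: carpet_digits_def)
      then have "\<bar>h * ?d $ l\<bar> \<le> h * 2" using h by (simp add: abs_mult)
      then show False using diff[of l] l h by linarith
    qed
    then show "a = b \<and> (i, j) = (i', j')" using diff[of 1] diff[of 2] h by simp
  qed
  then show ?case
    unfolding carpet_cells_Suc_image
    by (subst card_image) (simp_all add: card_cartesian_product card_carpet_digits Suc mult.commute)
qed

text \<open>Take the least stage whose side length is at most \<epsilon>. It is positive as
  \<open>\<epsilon> < 1\<close>, and minimality gives the strict bound at its predecessor.\<close>

lemma triadic_scale:
  assumes "0 < \<epsilon>" "\<epsilon> < (1::real)"
  obtains n where "1 / 3 ^ Suc n \<le> \<epsilon>" "\<epsilon> < 1 / 3 ^ n"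
proof -
  obtain k where k: "1 / \<epsilon> < 3 ^ k" using real_arch_pow[of 3 "1 / \<epsilon>"] by auto
  then have ex: "\<exists>k. 1 / 3 ^ k \<le> \<epsilon>" using assms by (intro exI[of _ k]) (simp add: field_simps)
  define m where "m = (LEAST k. 1 / 3 ^ k \<le> \<epsilon>)"
  have m: "1 / 3 ^ m \<le> \<epsilon>" unfolding m_def using ex by (rule LeastI_ex)
  have "m \<noteq> 0" using m assms by (intro notI) simp
  then obtain n where n: "m = Suc n" using not0_implies_Suc by blast
  have "\<not> 1 / 3 ^ n \<le> \<epsilon>" using not_less_Least[of n "\<lambda>k. 1 / 3 ^ k \<le> \<epsilon>"] n unfolding m_def by simp
  then show thesis using that m n by force
qed

section \<open>Box dimension bounds from the cell count\<close>

abbreviation carpet_dim :: real where "carpet_dim \<equiv> ln 8 / ln 3"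

text \<open>This fixes the exponent: at scale \<open>1 / 3 ^ n\<close> the power is exactly the
  number of cells.\<close>

lemma powr_triadic: "(1 / 3 ^ n) powr - carpet_dim = 8 ^ n"
proof -
  have "(1 / 3 ^ n) powr - carpet_dim = exp (n * ln 8)"
    by (simp add: powr_def ln_div ln_realpow)
  then show ?thesis by (simp add: exp_of_nat_mult)
qed

lemma carpet_dim_nonneg: "0 \<le> carpet_dim" by simp

lemma upper_box_dim_carpet_le: assumes "E \<subseteq> carpet" shows "upper_box_dim E \<le> carpet_dim"
proof (rule upper_box_dim_le[of 64 _ 1])
  fix \<epsilon> :: real assume \<epsilon>: "0 < \<epsilon>" "\<epsilon> < 1"
  then obtain n where n: "1 / 3 ^ Suc n \<le> \<epsilon>" "\<epsilon> < 1 / 3 ^ n" using triadic_scale by blast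
  \<comment> \<open>Two stages past \<open>n\<close> the cells have diameter at most
    \<open>2 / 3 ^ (n + 2)\<close>, which is below \<open>1 / 3 ^ Suc n\<close> and hence below
    \<epsilon>. The extra stages cost the factor \<open>8 ^ 2 = 64\<close>.\<close>
  let ?k = "Suc (Suc n)"
  have "covering_number \<epsilon> E \<le> card (cell carpet ?k ` carpet_cells ?k)"
  proof (rule covering_number_le)
    show "E \<subseteq> \<Union> (cell carpet ?k ` carpet_cells ?k)"
      using assms carpet_eq_cells[of ?k] by blast
    fix U assume "U \<in> cell carpet ?k ` carpet_cells ?k"
    then obtain a where a: "a \<in> carpet_cells ?k" "U = cell carpet ?k a" by blast
    have "bounded U"
      unfolding a using cell_subset_carpet[OF a(1)] compact_imp_bounded[OF compact_carpet] bounded_subset by blast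
    moreover have "diameter U \<le> \<epsilon>"
    proof (rule diameter_le)
      fix p q assume "p \<in> U" "q \<in> U"
      then have "dist p q \<le> 2 / 3 ^ ?k" using a dist_cell_le by blast
      also have "\<dots> \<le> 1 / 3 ^ Suc n" by (simp add: field_simps)
      finally show "norm (p - q) \<le> \<epsilon>" using n by (simp add: dist_norm)
    qed (use \<epsilon> in simp)
    ultimately show "bounded U \<and> diameter U \<le> \<epsilon>" by simp
  qed (intro finite_imageI finite_carpet_cells)
  also have "\<dots> \<le> 8 ^ ?k" using card_image_le[OF finite_carpet_cells] by (metis card_carpet_cells)
  finally have "real (covering_number \<epsilon> E) \<le> real (8 ^ ?k)" by (rule of_nat_mono)
  also have "\<dots> = 64 * (1 / 3 ^ n) powr - carpet_dim" unfolding powr_triadic by simp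
  also have "\<dots> \<le> 64 * \<epsilon> powr - carpet_dim"
    using \<epsilon> n carpet_dim_nonneg by (intro mult_left_mono powr_mono2') auto
  finally show "real (covering_number \<epsilon> E) \<le> 64 * \<epsilon> powr - carpet_dim" .
qed auto

text \<open>The cell is a copy of the carpet scaled by \<open>1 / 3 ^ k\<close>, so the scaled
  corners of stage \<open>n\<close> give \<open>8 ^ n\<close> points of \<open>E\<close> at mutual
  distance at least \<open>1 / 3 ^ (k + n)\<close>.\<close>

lemma upper_box_dim_carpet_ge:
  assumes a: "a \<in> carpet_cells k" "cell carpet k a \<subseteq> E" and "bounded E"
  shows "carpet_dim \<le> upper_box_dim E"
\<comment> \<open>With \<open>1 / 3 ^ Suc m \<le> \<epsilon>\<close> and \<open>m = k + n\<close>,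
  the power of \<epsilon> is at most \<open>8 ^ Suc k * 8 ^ n\<close>; the constant cancels the
  first factor.\<close>
proof (rule upper_box_dim_ge[of "1 / 8 ^ Suc k" "1 / 3 ^ k"])
  fix \<epsilon> :: real assume \<epsilon>: "0 < \<epsilon>" "\<epsilon> < 1 / 3 ^ k"
  moreover have "1 / 3 ^ k \<le> (1 :: real)" by simp
  ultimately have "\<epsilon> < 1" by linarith
  then obtain m where m: "1 / 3 ^ Suc m \<le> \<epsilon>" "\<epsilon> < 1 / 3 ^ m" using triadic_scale \<epsilon> by blast
  have "1 / 3 ^ Suc m < (1 / 3 ^ k :: real)" using m \<epsilon> by linarith
  then have "(3::real) ^ k < 3 ^ Suc m" by (simp add: field_simps)
  then have "k < Suc m" by (rule power_less_imp_less_exp[rotated]) simp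
  then obtain n where n: "m = k + n" using le_Suc_ex less_Suc_eq_le by blast
  let ?f = "\<lambda>p. a + p /\<^sub>R 3 ^ k"
  have sep: "\<epsilon> < dist (?f p) (?f q)" if pq: "p \<in> carpet_cells n" "q \<in> carpet_cells n" "p \<noteq> q" for p q
  proof -
    obtain i where "1 / 3 ^ n \<le> \<bar>p $ i - q $ i\<bar>" using carpet_cells_separated pq by blast
    also have "\<dots> \<le> dist p q" using component_le_norm_cart[of "p - q" i] by (simp add: dist_norm)
    finally have "1 / 3 ^ n / 3 ^ k \<le> dist p q / 3 ^ k" by (intro divide_right_mono) auto
    moreover have "\<epsilon> < 1 / 3 ^ n / 3 ^ k" using m n by (simp add: power_add mult.commute)
    ultimately show ?thesis by (simp add: dist_inverse_scaleR)
  qed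
  have "?f ` carpet_cells n \<subseteq> E"
    using a(2) carpet_cells_subset_carpet[of n] unfolding cell_def by blast
  then have "card (?f ` carpet_cells n) \<le> covering_number \<epsilon> E"
    using sep \<epsilon> \<open>bounded E\<close> by (intro card_le_covering_number) auto
  then have N: "8 ^ n \<le> covering_number \<epsilon> E"
    by (subst (asm) card_image) (auto simp: inj_on_def card_carpet_cells)
  have "1 / 8 ^ Suc k * \<epsilon> powr - carpet_dim \<le> 1 / 8 ^ Suc k * (1 / 3 ^ Suc m) powr - carpet_dim"
    using \<epsilon> m carpet_dim_nonneg by (intro mult_left_mono powr_mono2') auto
  also have "\<dots> = real (8 ^ n)" unfolding powr_triadic n by (simp add: power_add)
  also have "\<dots> \<le> real (covering_number \<epsilon> E)" using N by (rule of_nat_mono)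
  finally show "1 / 8 ^ Suc k * \<epsilon> powr - carpet_dim \<le> real (covering_number \<epsilon> E)" .
qed auto

theorem pbox_dim_carpet:
  assumes x: "x \<in> carpet" shows "pbox_dim carpet x = ereal carpet_dim"
proof (rule antisym)
  show "pbox_dim carpet x \<le> ereal carpet_dim"
    by (intro pbox_dim_le upper_box_dim_carpet_le) auto
  have "carpet_dim \<le> upper_box_dim (carpet \<inter> ball x r)" if "0 < r" for r
  proof -
    \<comment> \<open>At such a stage the cell containing \<open>x\<close> has diameter less than
      \<open>r\<close> and so lies in the ball.\<close>
    obtain k where k: "2 / 3 ^ k < r" using small_power_3[OF \<open>0 < r\<close>] by blast
    obtain a where a: "a \<in> carpet_cells k" "x \<in> cell carpet k a"
      using x carpet_eq_cells[of k] by blast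
    have "cell carpet k a \<subseteq> carpet \<inter> ball x r"
      using cell_subset_carpet[OF a(1)] dist_cell_le[OF a(2)] k by fastforce
    then show ?thesis
      using upper_box_dim_carpet_ge[OF a(1)] bounded_subset[OF bounded_ball] by blast
  qed
  moreover have "x \<in> closure carpet" using x closure_subset by blast
  ultimately show "ereal carpet_dim \<le> pbox_dim carpet x"
    by (auto simp: pbox_dim_def intro: INF_greatest)
qed

theorem proposition4p55:
  shows "carpet_vertices \<subseteq> carpet \<and> carpet \<subseteq> closure carpet_vertices \<and>
    (\<forall>x\<in>carpet_vertices. pbox_dim carpet x = ereal (ln 8 / ln 3)) \<and>
    (\<forall>x\<in>carpet_vertices. cross_dim carpet x = 2) \<and>
    (\<forall>x\<in>carpet_vertices. pbox_dim carpet x < cross_dim carpet x)"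
proof -
  \<comment> \<open>The strict inequality of the two dimensions is \<open>8 < 3 ^ 2\<close>.\<close>
  have "ln (8::real) < ln (3 ^ 2)" by simp
  then have "ln 8 < 2 * ln (3::real)" by (simp only: ln_realpow)
  then have "carpet_dim < 2" by (simp add: field_simps)
  then have "ereal carpet_dim < 2" by (metis ereal_less(2) less_ereal.simps(1) numeral_eq_ereal)
  moreover have "pbox_dim carpet x = ereal carpet_dim" if "x \<in> carpet_vertices" for x
    using that carpet_vertices_subset_carpet pbox_dim_carpet by blast
  ultimately show ?thesis
    using carpet_vertices_subset_carpet carpet_subset_closure_vertices cross_dim_carpet_vertex by simp
qed

end
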